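(* Let $k,r$ be positive integers, let $p$ be a prime, and let $s$ be the size of the smallest arithmetic set in $\mathbb{F}_p$. Suppose that $s^{kr}<p$, and let $M_1,\dots,M_k\in\mathbb{F}_p^{n\times n}$ be invertible matrices. Then for any sets $X_{i,j}\subset\mathbb{F}_p$ with $|X_{i,j}|=p-r$, $(i,j)\in[k]\times[n]$, there exists $x\in\mathbb{F}_p^n$ such that $(M_ix)(j)\in X_{i,j}$ for all $(i,j)\in[k]\times[n]$.
   Context: $(M_ix)(j)$ denotes the $j$-th coordinate of $M_ix$. A set $A\subset\mathbb{F}_p$ is arithmetic if (1) for every $a\in A$ there exists $b\in\mathbb{F}_p^*$ with $a-b,a,a+b\in A$, and (2) for every $a\in\mathbb{F}_p\setminus A$ there exists $b\in\mathbb{F}_p^*$ with $a+b\in A$. *)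

theory Defs
  imports
    "Berlekamp_Zassenhaus.Finite_Field"
    "Jordan_Normal_Form.Matrix"
begin

definition arithmetic :: "'p::prime_card mod_ring set \<Rightarrow> bool" where
  "arithmetic A \<longleftrightarrow>
     (\<forall>a\<in>A. \<exists>b. b \<noteq> 0 \<and> a - b \<in> A \<and> a \<in> A \<and> a + b \<in> A) \<and>
     (\<forall>a. a \<notin> A \<longrightarrow> (\<exists>b. b \<noteq> 0 \<and> a + b \<in> A))"

text \<open>There is always an arithmetic set, so the minimum over
  the sizes of arithmetic sets is taken over a nonempty set.\<close>

lemma arithmetic_UNIV: "arithmetic (UNIV :: 'p::prime_card mod_ring set)"
  unfolding arithmetic_def by (auto intro: exI[of _ 1])

end

(* Enumerating the at most r forbidden values of each X i j turns the claim into: k r families of n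
   affine hyperplanes, each family having independent normals, do not cover the space. Suppose they
   do, and let S be a minimal subcover. Expanding a product of character factors vanishing on the
   hyperplanes gives relations b_t \<phi>_t = \<Sum>_{u \<in> S - {t}} \<epsilon>_u b_u \<phi>_u with \<epsilon>_u \<in> {-1,0,1} for arbitrary
   nonzero scales b. As an arithmetic set A admits a step b_u in both directions from each of its
   elements, such a relation moves one bad coefficient of a combination over S into A while
   keeping the good ones in A. So the span W of S has at most s^|S| elements. But |W| \<ge> p^|S_d| for
   the part S_d of S in family d, and multiplying over d gives p^|S| \<le> (s^(k r))^|S|, which is
   impossible. *)
theory Submission
  imports Defs "HOL-Library.FuncSet" "Berlekamp_Zassenhaus.Berlekamp_Type_Based"
begin

section \<open>Additive characters of the prime field\<close>

definition add_char :: "'p::prime_card mod_ring \<Rightarrow> complex" where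
  "add_char y = cis (2 * pi * real_of_int (to_int_mod_ring y) / real CARD('p))"

lemma add_char_add:
  fixes x y :: "'p::prime_card mod_ring"
  shows "add_char (x + y) = add_char x * add_char y"
proof -
  let ?p = "int CARD('p)" and ?a = "to_int_mod_ring x" and ?b = "to_int_mod_ring y"
  \<comment> \<open>The carry of the two representatives; it only contributes the factor
    \<open>cis (2 * pi * q) = 1\<close>.\<close>
  define q where "q = (?a + ?b) div ?p"
  have "?a + ?b = ?p * q + to_int_mod_ring (x + y)"
    by (simp add: q_def to_int_mod_ring_add)
  hence "real_of_int (?a + ?b) = real_of_int (?p * q + to_int_mod_ring (x + y))"
    by (rule arg_cong)
  hence "(2 * pi / real CARD('p)) * (real_of_int ?a + real_of_int ?b)
      = (2 * pi / real CARD('p)) * (real CARD('p) * real_of_int q + real_of_int (to_int_mod_ring (x + y)))"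
    by simp
  hence "2 * pi * real_of_int ?a / real CARD('p) + 2 * pi * real_of_int ?b / real CARD('p)
      = 2 * pi * real_of_int q + 2 * pi * real_of_int (to_int_mod_ring (x + y)) / real CARD('p)"
    by (simp add: distrib_left)
  hence "add_char x * add_char y = cis (2 * pi * real_of_int q) * add_char (x + y)"
    unfolding add_char_def cis_mult by (rule arg_cong)
  thus ?thesis by simp
qed

lemma add_char_0 [simp]: "add_char 0 = 1"
  by (simp add: add_char_def)

text \<open>Distinct representatives below \<open>CARD('p)\<close> give distinct roots of unity, so
  the kernel is trivial.\<close>

lemma add_char_eq_1_iff [simp]:
  fixes y :: "'p::prime_card mod_ring"
  shows "add_char y = 1 \<longleftrightarrow> y = 0"
proof
  assume "add_char y = 1"
  moreover obtain m where m: "to_int_mod_ring y = int m" "m < CARD('p)"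
    using range_to_int_mod_ring[where 'a = 'p]
    by (metis atLeastLessThan_iff nonneg_int_cases of_nat_less_iff rangeI)
  ultimately have "cis (2 * pi * real m / real CARD('p)) = cis (2 * pi * real 0 / real CARD('p))"
    by (simp add: add_char_def)
  hence "m = 0"
    using bij_betw_roots_unity[of "CARD('p)"] m unfolding bij_betw_def inj_on_def by auto
  thus "y = 0" using m by (metis of_nat_0 to_int_mod_ring_hom.hom_0_iff)
qed simp

lemma add_char_uminus: "add_char (- y) = cnj (add_char y)"
proof -
  have "add_char (- y) * add_char y = 1"
    by (simp flip: add_char_add)
  moreover have "cnj (add_char y) * add_char y = 1"
    by (simp add: add_char_def cis_cnj cis_mult)
  ultimately show ?thesis
    by (metis mult_right_cancel mult_zero_right zero_neq_one)
qed

lemma add_char_sum: "add_char (\<Sum>i\<in>A. f i) = (\<Prod>i\<in>A. add_char (f i))"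
  by (induction A rule: infinite_finite_induct) (auto simp: add_char_add)

section \<open>Character sums and the exchange relation\<close>

text \<open>Relative to a set \<open>V\<close> because vectors of a fixed dimension form a carrier
  and not a type.\<close>

definition additive_on :: "'v::plus set \<Rightarrow> ('v \<Rightarrow> 'a::plus) \<Rightarrow> bool" where
  "additive_on V f \<longleftrightarrow> (\<forall>x\<in>V. \<forall>y\<in>V. f (x + y) = f x + f y)"

text \<open>Translation by \<open>x0\<close> permutes the space, yet multiplies the sum by
  \<open>add_char (\<psi> x0)\<close>, which is not 1.\<close>

lemma sum_add_char_eq_0:
  fixes \<psi> :: "'p::prime_card mod_ring vec \<Rightarrow> 'p mod_ring"
  assumes "additive_on (carrier_vec n) \<psi>" and "x0 \<in> carrier_vec n" and "\<psi> x0 \<noteq> 0"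
  shows "(\<Sum>x\<in>carrier_vec n. add_char (\<psi> x)) = 0"
proof -
  let ?S = "\<Sum>x\<in>carrier_vec n. add_char (\<psi> x)"
  have "?S = (\<Sum>x\<in>carrier_vec n. add_char (\<psi> (x + x0)))"
    by (rule sum.reindex_bij_witness[of _ "\<lambda>x. x + x0" "\<lambda>x. x - x0"])
       (use assms(2) in \<open>auto intro!: arg_cong[of _ _ add_char] arg_cong[of _ _ \<psi>] eq_vecI\<close>)
  also have "\<dots> = ?S * add_char (\<psi> x0)"
    using assms by (simp add: additive_on_def add_char_add sum_distrib_right)
  finally have "?S * (add_char (\<psi> x0) - 1) = 0"
    by (simp add: algebra_simps)
  thus ?thesis using assms(3) by simp
qed

lemma additive_on_lincomb:
  fixes \<phi> :: "'i \<Rightarrow> 'v::plus \<Rightarrow> 'a::comm_ring"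
  assumes "\<And>u. u \<in> S \<Longrightarrow> additive_on V (\<phi> u)"
  shows "additive_on V (\<lambda>x. \<Sum>u\<in>S. a u * \<phi> u x)"
  using assms by (simp add: additive_on_def distrib_left sum.distrib)

text \<open>\<open>P x = (\<Prod>u\<in>R. 1 - add_char (b u * (\<phi> u x - c u)))\<close> vanishes off the hyperplane of \<open>t\<close>, so
  \<open>|P|\<^sup>2\<close> is unchanged when multiplied by \<open>add_char (b t * (\<phi> t x - c t))\<close>. If the conclusion failed,
  every character in the expansion of that product would be nontrivial, giving
  \<open>(\<Sum>x. |P x|\<^sup>2) = 0\<close>.\<close>
lemma exchange:
  fixes \<phi> :: "'i \<Rightarrow> 'p::prime_card mod_ring vec \<Rightarrow> 'p mod_ring"
  assumes fin: "finite R"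
    and add: "\<And>u. u \<in> insert t R \<Longrightarrow> additive_on (carrier_vec n) (\<phi> u)"
    and b: "\<And>u. u \<in> R \<Longrightarrow> b u \<noteq> 0"
    and cover: "\<And>x. x \<in> carrier_vec n \<Longrightarrow> \<exists>u\<in>insert t R. \<phi> u x = c u"
    and x0: "x0 \<in> carrier_vec n" "\<And>u. u \<in> R \<Longrightarrow> \<phi> u x0 \<noteq> c u"
  obtains \<epsilon> where "\<And>u. \<epsilon> u \<in> {-1, 0, 1}"
    and "\<And>x. x \<in> carrier_vec n \<Longrightarrow> b t * \<phi> t x = (\<Sum>u\<in>R. \<epsilon> u * b u * \<phi> u x)"
proof -
  let ?V = "carrier_vec n :: 'p mod_ring vec set"
  \<comment> \<open>\<open>T\<close> indexes a term in the expansion of \<open>P\<close>,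
    \<open>U\<close> one of its conjugate, so \<open>u\<close> enters with opposite signs from the
    two and cancels when it lies in both.\<close>
  define \<epsilon> :: "'i set \<Rightarrow> 'i set \<Rightarrow> 'i \<Rightarrow> 'p mod_ring"
    where "\<epsilon> T U u = of_bool (u \<in> U) - of_bool (u \<in> T)" for T U u
  have "\<exists>T\<in>Pow R. \<exists>U\<in>Pow R. \<forall>x\<in>?V. b t * \<phi> t x = (\<Sum>u\<in>R. \<epsilon> T U u * b u * \<phi> u x)"
  proof (rule ccontr)
    assume neg: "\<not> ?thesis"
    define P where "P x = (\<Prod>u\<in>R. 1 - add_char (b u * (\<phi> u x - c u)))" for x
    define L where "L T x = (\<Sum>u\<in>T. b u * \<phi> u x)" for T x
    \<comment> \<open>Each term of the expansion splits into a constant \<open>K T\<close> and the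
      character of the additive map \<open>L T\<close>, so that sums over \<open>x\<close> see only
      the latter.\<close>
    define K where "K T = (-1) ^ card T * add_char (- (\<Sum>u\<in>T. b u * c u))" for T
    have P_expand: "P x = (\<Sum>T\<in>Pow R. K T * add_char (L T x))" for x
    proof -
      have "P x = (\<Prod>u\<in>R. - add_char (b u * (\<phi> u x - c u)) + 1)"
        by (simp add: P_def)
      also have "\<dots> = (\<Sum>T\<in>Pow R. \<Prod>u\<in>T. - add_char (b u * (\<phi> u x - c u)))"
        by (subst prod_add[OF fin]) simp
      also have "\<dots> = (\<Sum>T\<in>Pow R. K T * add_char (L T x))"
      proof (rule sum.cong[OF refl])
        fix T
        have "(\<Prod>u\<in>T. - add_char (b u * (\<phi> u x - c u)))
            = (-1) ^ card T * add_char (\<Sum>u\<in>T. b u * (\<phi> u x - c u))"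
          by (simp add: add_char_sum prod_uminus)
        also have "(\<Sum>u\<in>T. b u * (\<phi> u x - c u)) = - (\<Sum>u\<in>T. b u * c u) + L T x"
          by (simp add: L_def right_diff_distrib sum_subtractf)
        finally show "(\<Prod>u\<in>T. - add_char (b u * (\<phi> u x - c u))) = K T * add_char (L T x)"
          by (simp only: K_def add_char_add mult.assoc)
      qed
      finally show ?thesis .
    qed
    have "(\<Sum>x\<in>?V. cnj (P x) * P x) = (\<Sum>x\<in>?V. cnj (P x) * P x * add_char (b t * (\<phi> t x - c t)))"
    proof (rule sum.cong[OF refl])
      fix x assume "x \<in> ?V"
      from cover[OF this] have "P x = 0 \<or> \<phi> t x = c t"
        using fin by (auto simp: P_def)
      thus "cnj (P x) * P x = cnj (P x) * P x * add_char (b t * (\<phi> t x - c t))"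
        by auto
    qed
    also have "\<dots> = (\<Sum>x\<in>?V. \<Sum>T\<in>Pow R. \<Sum>U\<in>Pow R. cnj (K U) * K T * add_char (- (b t * c t))
        * add_char (b t * \<phi> t x - L U x + L T x))"
    proof -
      have "cnj (K U * add_char (L U x)) * (K T * add_char (L T x)) * add_char (b t * (\<phi> t x - c t))
          = cnj (K U) * K T * add_char (- (b t * c t)) * add_char (b t * \<phi> t x - L U x + L T x)"
        for U T x
      proof -
        have "add_char (b t * (\<phi> t x - c t)) = add_char (- (b t * c t)) * add_char (b t * \<phi> t x)"
          by (simp add: algebra_simps flip: add_char_add)
        moreover have "add_char (b t * \<phi> t x - L U x + L T x)
            = add_char (b t * \<phi> t x) * cnj (add_char (L U x)) * add_char (L T x)"
          by (simp flip: add_char_add add_char_uminus)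
        ultimately show ?thesis by simp
      qed
      thus ?thesis
        by (simp only: P_expand cnj_sum sum_distrib_left sum_distrib_right)
    qed
    also have "\<dots> = (\<Sum>T\<in>Pow R. \<Sum>U\<in>Pow R. cnj (K U) * K T * add_char (- (b t * c t))
        * (\<Sum>x\<in>?V. add_char (b t * \<phi> t x - L U x + L T x)))"
      by (subst sum.swap, rule sum.cong[OF refl], subst sum.swap) (simp add: sum_distrib_left)
    also have "\<dots> = 0"
    proof (intro sum.neutral ballI)
      \<comment> \<open>The negated claim provides a point where the exponent is nonzero, so its
        character sum vanishes.\<close>
      fix T U assume UT: "T \<in> Pow R" "U \<in> Pow R"
      then obtain x where x: "x \<in> ?V" "b t * \<phi> t x \<noteq> (\<Sum>u\<in>R. \<epsilon> T U u * b u * \<phi> u x)"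
        using neg by blast
      have restrict: "L T x = (\<Sum>u\<in>R. of_bool (u \<in> T) * b u * \<phi> u x)" if "T \<subseteq> R" for T
        unfolding L_def using that fin by (intro sum.mono_neutral_cong_left) auto
      have "(\<Sum>u\<in>R. \<epsilon> T U u * b u * \<phi> u x) = L U x - L T x"
        using UT by (simp add: restrict \<epsilon>_def left_diff_distrib sum_subtractf)
      moreover have "b t * \<phi> t x - L U x + L T x = b t * \<phi> t x - (L U x - L T x)"
        by simp
      ultimately have "b t * \<phi> t x - L U x + L T x \<noteq> 0"
        using x(2) by (metis eq_iff_diff_eq_0)
      moreover have "additive_on ?V (\<lambda>x. b t * \<phi> t x - L U x + L T x)"
      proof -
        have "additive_on ?V (L T)" "additive_on ?V (L U)"
          unfolding L_def using UT add by (auto intro!: additive_on_lincomb)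
        thus ?thesis
          using add[of t] by (simp add: additive_on_def algebra_simps)
      qed
      ultimately show "cnj (K U) * K T * add_char (- (b t * c t))
          * (\<Sum>x\<in>?V. add_char (b t * \<phi> t x - L U x + L T x)) = 0"
        using sum_add_char_eq_0[OF _ x(1)] by simp
    qed
    finally have "(\<Sum>x\<in>?V. of_real ((norm (P x))\<^sup>2) :: complex) = 0"
      by (simp add: complex_norm_square mult.commute del: of_real_power)
    hence "(\<Sum>x\<in>?V. (norm (P x))\<^sup>2) = 0"
      by (metis of_real_eq_0_iff of_real_sum)
    \<comment> \<open>A vanishing sum of squares kills \<open>P\<close> everywhere, whereas at
      \<open>x0\<close> no factor of \<open>P\<close> is zero.\<close>
    hence "P x0 = 0"
      using x0(1) finite_carrier_vec by (subst (asm) sum_nonneg_eq_0_iff) auto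
    thus False
      using fin b x0(2) by (simp add: P_def)
  qed
  then obtain T U where "\<And>x. x \<in> ?V \<Longrightarrow> b t * \<phi> t x = (\<Sum>u\<in>R. \<epsilon> T U u * b u * \<phi> u x)"
    by blast
  moreover have "\<epsilon> T U u \<in> {-1, 0, 1}" for u
    by (simp add: \<epsilon>_def)
  ultimately show ?thesis by (rule that[rotated])
qed

section \<open>Moving coefficients into an arithmetic set\<close>

text \<open>Induction on the number of coefficients outside \<open>A\<close>. Minimality of the
  cover supplies the point \<open>x0\<close> that the exchange relation requires.\<close>

lemma lincomb_with_arithmetic_coefficients:
  fixes \<phi> :: "'i \<Rightarrow> 'p::prime_card mod_ring vec \<Rightarrow> 'p mod_ring"
  assumes A: "arithmetic A" and fin: "finite S"
    and add: "\<And>u. u \<in> S \<Longrightarrow> additive_on (carrier_vec n) (\<phi> u)"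
    and cover: "\<And>x. x \<in> carrier_vec n \<Longrightarrow> \<exists>u\<in>S. \<phi> u x = c u"
    and minimal: "\<And>t. t \<in> S \<Longrightarrow> \<exists>x\<in>carrier_vec n. \<forall>u\<in>S - {t}. \<phi> u x \<noteq> c u"
  shows "\<exists>a'. (\<forall>u\<in>S. a' u \<in> A) \<and>
    (\<forall>x\<in>carrier_vec n. (\<Sum>u\<in>S. a u * \<phi> u x) = (\<Sum>u\<in>S. a' u * \<phi> u x))"
proof (induction "card {u \<in> S. a u \<notin> A}" arbitrary: a rule: less_induct)
  case less
  show ?case
  proof (cases "\<exists>t\<in>S. a t \<notin> A")
    case False
    thus ?thesis by auto
  next
    case True
    then obtain t where t: "t \<in> S" "a t \<notin> A" by blast
    let ?R = "S - {t}"
    \<comment> \<open>One step function serves both clauses of \<open>arithmetic\<close>: two-sided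
      inside \<open>A\<close>, one-sided outside.\<close>
    have "\<exists>b. b \<noteq> 0 \<and> (y \<in> A \<longrightarrow> y - b \<in> A) \<and> y + b \<in> A" for y
      using A unfolding arithmetic_def by (cases "y \<in> A") blast+
    then obtain step where step: "\<And>y. step y \<noteq> 0" "\<And>y. y \<in> A \<Longrightarrow> y - step y \<in> A"
        "\<And>y. y + step y \<in> A"
      by metis
    obtain x0 where x0: "x0 \<in> carrier_vec n" "\<And>u. u \<in> ?R \<Longrightarrow> \<phi> u x0 \<noteq> c u"
      using minimal[OF t(1)] by blast
    have ins: "insert t ?R = S" using t by blast
    obtain \<epsilon> where \<epsilon>: "\<And>u. \<epsilon> u \<in> {-1, 0, 1}"
      and eq: "\<And>x. x \<in> carrier_vec n \<Longrightarrow>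
        step (a t) * \<phi> t x = (\<Sum>u\<in>?R. \<epsilon> u * step (a u) * \<phi> u x)"
      by (rule exchange[of ?R t n \<phi> "\<lambda>u. step (a u)" c x0, unfolded ins])
         (use fin add cover x0 step(1) in \<open>blast | simp\<close>)+
    \<comment> \<open>Adds the left side of the relation \<open>eq\<close> and subtracts its right
      side, so the combination keeps its value.\<close>
    define a1 where "a1 u = (if u = t then a t + step (a t) else a u - \<epsilon> u * step (a u))" for u
    \<comment> \<open>Here \<open>u\<close> differs from \<open>t\<close>, and its coefficient stays
      put or moves one step either way within \<open>A\<close>. Other bad coefficients may move
      anywhere.\<close>
    have good: "a1 u \<in> A" if "a u \<in> A" for u
      using \<epsilon>[of u] step that t(2) by (auto simp: a1_def)
    have "a1 t \<in> A" using step(3) by (simp add: a1_def)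
    hence "card {u \<in> S. a1 u \<notin> A} < card {u \<in> S. a u \<notin> A}"
      using t good fin by (intro psubset_card_mono) auto
    from less[OF this] obtain a' where a': "\<forall>u\<in>S. a' u \<in> A"
      "\<forall>x\<in>carrier_vec n. (\<Sum>u\<in>S. a1 u * \<phi> u x) = (\<Sum>u\<in>S. a' u * \<phi> u x)" by blast
    have "(\<Sum>u\<in>S. a1 u * \<phi> u x) = (\<Sum>u\<in>S. a u * \<phi> u x)" if "x \<in> carrier_vec n" for x
    proof -
      have "(\<Sum>u\<in>S. a1 u * \<phi> u x) = (a t + step (a t)) * \<phi> t x
          + (\<Sum>u\<in>?R. a u * \<phi> u x - \<epsilon> u * step (a u) * \<phi> u x)"
        by (subst sum.remove[OF fin t(1)]) (simp add: a1_def left_diff_distrib)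
      also have "\<dots> = a t * \<phi> t x + (\<Sum>u\<in>?R. a u * \<phi> u x)"
        using eq[OF that] by (simp add: sum_subtractf distrib_right)
      also have "\<dots> = (\<Sum>u\<in>S. a u * \<phi> u x)"
        by (rule sum.remove[OF fin t(1), symmetric])
      finally show ?thesis .
    qed
    with a' show ?thesis by (intro exI[of _ a']) simp
  qed
qed

section \<open>Minimal covers and counting combinations\<close>

lemma exists_minimal_subset:
  assumes "finite I" and "Q I"
  obtains S where "S \<subseteq> I" "Q S" "\<And>t. t \<in> S \<Longrightarrow> \<not> Q (S - {t})"
proof -
  have "\<exists>S. (S \<subseteq> I \<and> Q S) \<and> (\<forall>S'. S' \<subseteq> I \<and> Q S' \<longrightarrow> card S \<le> card S')"
    by (rule ex_has_least_nat[of "\<lambda>S. S \<subseteq> I \<and> Q S" I]) (use assms in simp)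
  then obtain S where S: "S \<subseteq> I" "Q S" "\<And>S'. S' \<subseteq> I \<Longrightarrow> Q S' \<Longrightarrow> card S \<le> card S'" by blast
  have "\<not> Q (S - {t})" if "t \<in> S" for t
  proof
    assume "Q (S - {t})"
    hence "card S \<le> card (S - {t})" using S(1) by (intro S(3)) auto
    thus False using card_Diff1_less[OF finite_subset[OF S(1) assms(1)] that] by simp
  qed
  with S that show ?thesis by blast
qed

text \<open>\<open>C\<close> indexes the families and \<open>J\<close> the hyperplanes within one.
  Independence of the normals is phrased in \<open>dual\<close> by dual vectors, which later read
  off coefficients.\<close>

theorem avoid_hyperplanes:
  fixes \<phi> :: "'c \<times> 'j \<Rightarrow> 'p::prime_card mod_ring vec \<Rightarrow> 'p mod_ring"
    and A :: "'p mod_ring set"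
  assumes A: "arithmetic A" and small: "card A ^ card C < CARD('p)"
    and fin: "finite C" "finite J"
    and add: "\<And>u. u \<in> C \<times> J \<Longrightarrow> additive_on (carrier_vec n) (\<phi> u)"
    and dual: "\<And>d j. d \<in> C \<Longrightarrow> j \<in> J \<Longrightarrow>
      \<exists>x\<in>carrier_vec n. \<forall>j'\<in>J. \<phi> (d, j') x = of_bool (j' = j)"
  shows "\<exists>x\<in>carrier_vec n. \<forall>u\<in>C \<times> J. \<phi> u x \<noteq> c u"
proof (rule ccontr)
  let ?V = "carrier_vec n :: 'p mod_ring vec set"
  assume "\<not> ?thesis"
  hence cover_all: "\<forall>x\<in>?V. \<exists>u\<in>C \<times> J. \<phi> u x = c u" by blast
  obtain S where S: "S \<subseteq> C \<times> J" and cover: "\<forall>x\<in>?V. \<exists>u\<in>S. \<phi> u x = c u"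
    and minimal: "\<And>t. t \<in> S \<Longrightarrow> \<not> (\<forall>x\<in>?V. \<exists>u\<in>S - {t}. \<phi> u x = c u)"
    using exists_minimal_subset[of "C \<times> J" "\<lambda>S. \<forall>x\<in>?V. \<exists>u\<in>S. \<phi> u x = c u"] fin cover_all
    by (metis finite_cartesian_product)
  have finS: "finite S" using S fin by (meson finite_SigmaI finite_subset)
  \<comment> \<open>Restricting to the carrier turns agreement on the space into equality of
    functions, so that \<open>W\<close> can be counted.\<close>
  define lincomb where "lincomb a = (\<lambda>x\<in>?V. \<Sum>u\<in>S. a u * \<phi> u x)" for a
  define W where "W = lincomb ` (S \<rightarrow>\<^sub>E UNIV)"
  have finW: "finite W" unfolding W_def using finS by (intro finite_imageI finite_PiE) auto
  have "W \<subseteq> lincomb ` (S \<rightarrow>\<^sub>E A)"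
  proof
    fix w assume "w \<in> W"
    then obtain a where a: "w = lincomb a" by (auto simp: W_def)
    have "\<exists>a'. (\<forall>u\<in>S. a' u \<in> A) \<and>
      (\<forall>x\<in>?V. (\<Sum>u\<in>S. a u * \<phi> u x) = (\<Sum>u\<in>S. a' u * \<phi> u x))"
    proof (rule lincomb_with_arithmetic_coefficients[OF A finS])
      show "additive_on ?V (\<phi> u)" if "u \<in> S" for u
        using add S that by blast
      show "\<exists>u\<in>S. \<phi> u x = c u" if "x \<in> ?V" for x
        using cover that by blast
      show "\<exists>x\<in>?V. \<forall>u\<in>S - {t}. \<phi> u x \<noteq> c u" if "t \<in> S" for t
        using minimal[OF that] by blast
    qed
    then obtain a' where a': "\<forall>u\<in>S. a' u \<in> A"
      "\<forall>x\<in>?V. (\<Sum>u\<in>S. a u * \<phi> u x) = (\<Sum>u\<in>S. a' u * \<phi> u x)" by blast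
    have "w = lincomb (restrict a' S)"
      unfolding a lincomb_def using a'(2) by (intro restrict_ext) simp
    thus "w \<in> lincomb ` (S \<rightarrow>\<^sub>E A)" using a'(1) by auto
  qed
  hence "card W \<le> card (lincomb ` (S \<rightarrow>\<^sub>E A))"
    using finS by (intro card_mono finite_imageI finite_PiE) auto
  also have "\<dots> \<le> card (S \<rightarrow>\<^sub>E A)"
    using finS by (intro card_image_le finite_PiE) auto
  also have "\<dots> = card A ^ card S"
    using finS by (simp add: card_PiE)
  finally have W_upper: "card W \<le> card A ^ card S" .
  have W_lower: "CARD('p) ^ card {j. (d, j) \<in> S} \<le> card W" if "d \<in> C" for d
  proof -
    let ?J = "{j. (d, j) \<in> S}"
    \<comment> \<open>Zero coefficients outside family \<open>d\<close> leave only functionals that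
      the dual vectors separate.\<close>
    define extend :: "('j \<Rightarrow> 'p mod_ring) \<Rightarrow> 'c \<times> 'j \<Rightarrow> 'p mod_ring"
      where "extend a = (\<lambda>u\<in>S. if fst u = d then a (snd u) else 0)" for a
    have sub: "?J \<subseteq> J" using S by auto
    hence finJ: "finite ?J" using fin finite_subset by blast
    have eval: "lincomb (extend a) x = a j"
      if "j \<in> ?J" "x \<in> ?V" "\<forall>j'\<in>J. \<phi> (d, j') x = of_bool (j' = j)" for a j x
    proof -
      have "lincomb (extend a) x = (\<Sum>u\<in>S. if u = (d, j) then a j else 0)"
      proof -
        have "\<phi> (d, j') x = of_bool (j' = j)" if "(d, j') \<in> S" for j'
          using \<open>\<forall>j'\<in>J. _ j'\<close> that S by blast
        thus ?thesis
          using \<open>x \<in> ?V\<close> by (auto simp: lincomb_def extend_def intro!: sum.cong)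
      qed
      thus ?thesis using that finS by simp
    qed
    \<comment> \<open>Evaluation at the dual vector of \<open>j\<close> recovers
      \<open>a j\<close>.\<close>
    have "inj_on (\<lambda>a. lincomb (extend a)) (?J \<rightarrow>\<^sub>E UNIV)"
    proof (rule inj_onI)
      fix a a' assume aa: "a \<in> ?J \<rightarrow>\<^sub>E UNIV" "a' \<in> ?J \<rightarrow>\<^sub>E UNIV" "lincomb (extend a) = lincomb (extend a')"
      show "a = a'"
      proof (rule PiE_ext[OF aa(1,2)])
        fix j assume j: "j \<in> ?J"
        with sub dual[OF that] obtain x where "x \<in> ?V" "\<forall>j'\<in>J. \<phi> (d, j') x = of_bool (j' = j)"
          by blast
        with eval[OF j] aa(3) show "a j = a' j" by metis
      qed
    qed
    moreover have "(\<lambda>a. lincomb (extend a)) ` (?J \<rightarrow>\<^sub>E UNIV) \<subseteq> W"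
      by (auto simp: W_def extend_def)
    ultimately have "card (?J \<rightarrow>\<^sub>E (UNIV :: 'p mod_ring set)) \<le> card W"
      using finW by (rule card_inj_on_le)
    thus ?thesis using finJ by (simp add: card_PiE)
  qed
  \<comment> \<open>\<open>S\<close> is the disjoint union of its parts in the families, so the
    lower bounds multiply to the exponent \<open>card S\<close>.\<close>
  have S_Sigma: "S = (SIGMA d:C. {j. (d, j) \<in> S})" using S by auto
  have "finite {j. (d, j) \<in> S}" for d
    using S fin by (auto intro: rev_finite_subset[of J])
  hence "card S = (\<Sum>d\<in>C. card {j. (d, j) \<in> S})"
    using fin by (subst S_Sigma) (simp add: card_SigmaI)
  hence "CARD('p) ^ card S = (\<Prod>d\<in>C. CARD('p) ^ card {j. (d, j) \<in> S})"
    by (simp add: power_sum)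
  also have "\<dots> \<le> (\<Prod>d\<in>C. card W)"
    using W_lower by (intro prod_mono) auto
  also have "\<dots> = card W ^ card C" by simp
  also have "\<dots> \<le> (card A ^ card S) ^ card C"
    using W_upper by (rule power_mono) simp
  also have "\<dots> = (card A ^ card C) ^ card S"
    by (simp add: mult.commute flip: power_mult)
  finally have "CARD('p) ^ card S \<le> (card A ^ card C) ^ card S" .
  \<comment> \<open>Some hyperplane contains the zero vector; a positive exponent then keeps the
    inequality \<open>small\<close> strict.\<close>
  moreover have "S \<noteq> {}" using cover zero_carrier_vec by blast
  hence "card S > 0" using finS by (simp add: card_gt_0_iff)
  ultimately show False
    using power_strict_mono[OF small, of "card S"] by linarith
qed

section \<open>From matrices to families of hyperplanes\<close>

theorem theorem5p1:
  fixes k r n p s :: nat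
    and M :: "nat \<Rightarrow> 'p::prime_card mod_ring mat"
    and X :: "nat \<Rightarrow> nat \<Rightarrow> 'p mod_ring set"
  assumes "k > 0" and "r > 0"
    and "p = CARD('p)"
    and "s = Min (card ` {A :: 'p mod_ring set. arithmetic A})"
    and "s ^ (k * r) < p"
    and "\<And>i. i < k \<Longrightarrow> M i \<in> carrier_mat n n"
    and "\<And>i. i < k \<Longrightarrow> invertible_mat (M i)"
    and "\<And>i j. i < k \<Longrightarrow> j < n \<Longrightarrow> card (X i j) = p - r"
  shows "\<exists>x \<in> carrier_vec n. \<forall>i<k. \<forall>j<n. (M i *\<^sub>v x) $ j \<in> X i j"
proof -
  have "s \<in> card ` {A :: 'p mod_ring set. arithmetic A}"
    unfolding assms(4) using arithmetic_UNIV by (intro Min_in) auto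
  then obtain A :: "'p mod_ring set" where A: "arithmetic A" "card A = s" by blast
  \<comment> \<open>Only an inclusion: with truncated subtraction the complement has at most
    \<open>r\<close> elements, and surplus indices merely forbid further values.\<close>
  have "\<exists>f :: nat \<Rightarrow> 'p mod_ring. - X i j \<subseteq> f ` {..<r}" if "i < k" "j < n" for i j
  proof -
    have "card (- X i j) \<le> r"
      using assms(3,8) that by (simp add: Compl_eq_Diff_UNIV card_Diff_subset)
    moreover obtain f :: "nat \<Rightarrow> 'p mod_ring" where "f ` {0..<card (- X i j)} = - X i j"
      using ex_bij_betw_nat_finite[of "- X i j"] by (auto simp: bij_betw_def)
    ultimately show ?thesis by (intro exI[of _ f]) force
  qed
  then obtain f :: "nat \<Rightarrow> nat \<Rightarrow> nat \<Rightarrow> 'p mod_ring"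
    where f: "\<And>i j. i < k \<Longrightarrow> j < n \<Longrightarrow> - X i j \<subseteq> f i j ` {..<r}"
    by metis
  \<comment> \<open>Family \<open>(i, l)\<close> consists of the hyperplanes on which coordinate
    \<open>j\<close> of \<open>M i *\<^sub>v x\<close> equals \<open>f i j l\<close>, one for each
    \<open>j\<close>. This gives \<open>k * r\<close> families.\<close>
  let ?C = "{..<k} \<times> {..<r}"
  let ?\<phi> = "\<lambda>((i, l), j) x. (M i *\<^sub>v x) $ j"
  have "\<exists>x\<in>carrier_vec n. \<forall>u\<in>?C \<times> {..<n}. ?\<phi> u x \<noteq> (\<lambda>((i, l), j). f i j l) u"
  proof (rule avoid_hyperplanes[OF A(1)])
    show "card A ^ card ?C < CARD('p)"
      using assms A by simp
    show "additive_on (carrier_vec n) (?\<phi> u)" if u_in: "u \<in> ?C \<times> {..<n}" for u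
    proof -
      obtain i l j where u: "u = ((i, l), j)" "i < k" "j < n" using u_in by auto
      with assms(6) have M: "M i \<in> carrier_mat n n" by blast
      show ?thesis
        using u(3) M by (simp add: u(1) additive_on_def scalar_prod_add_distrib[where n = n])
    qed
    show "\<exists>x\<in>carrier_vec n. \<forall>j'\<in>{..<n}. ?\<phi> (d, j') x = of_bool (j' = j)"
      if dj: "d \<in> ?C" "j \<in> {..<n}" for d j
    proof -
      obtain i l where d: "d = (i, l)" "i < k" using dj by auto
      have M: "M i \<in> carrier_mat n n" using assms(6) d by blast
      then obtain B where B: "M i * B = 1\<^sub>m n" "B * M i = 1\<^sub>m (dim_row B)"
        using assms(7)[OF d(2)] by (auto simp: invertible_mat_def inverts_mat_def)
      \<comment> \<open>The dimensions of \<open>B\<close> are read off from the two identity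
        matrices.\<close>
      have Bc: "B \<in> carrier_mat n n"
        using B M by (metis carrier_matD(2) carrier_matI index_mult_mat(3) index_one_mat(3))
      \<comment> \<open>The columns of the inverse are the dual vectors to the rows of
        \<open>M i\<close>.\<close>
      have "M i *\<^sub>v (B *\<^sub>v unit_vec n j) = unit_vec n j"
        using B(1) M Bc by (simp flip: assoc_mult_mat_vec)
      thus ?thesis
        using Bc dj d by (intro bexI[of _ "B *\<^sub>v unit_vec n j"]) (auto simp del: index_mult_mat_vec)
    qed
  qed auto
  then obtain x where x: "x \<in> carrier_vec n"
    and avoid: "\<And>i l j. i < k \<Longrightarrow> l < r \<Longrightarrow> j < n \<Longrightarrow> (M i *\<^sub>v x) $ j \<noteq> f i j l"
    by auto
  have "(M i *\<^sub>v x) $ j \<in> X i j" if "i < k" "j < n" for i j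
    using f[OF that] avoid that by blast
  with x show ?thesis by blast
qed

end
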